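(* Let $n$ be a positive integer, $k$ an integer, and let $\pi$ be a permutation of $1,\dots,n$. Consider the $n\times n$ square whose first row is $\pi$ and in which each subsequent row is the cyclic shift by $k$ of the previous row, always in the same direction (either always to the left or always to the right). For either choice of direction, this square is a toroidal anti-queen Latin square if and only if $n$ is coprime with each of $k$, $k-1$, and $k+1$.
   Context: A Latin square of order $n$ is an $n\times n$ table filled with the integers $1,\dots,n$ so that each integer appears exactly once in each row and in each column. A toroidal anti-queen Latin square is a Latin square in which no two distinct cells separated by a chess queen's move on the torus contain the same number; here the square is viewed as a torus (left and right edges identified, top and bottom edges identified), so that distinct cells $(i,j)$ and $(i',j')$ are separated by a queen's move if $i=i'$, or $j=j'$, or $i-i'\equiv \pm(j-j') \pmod n$. *)

theory Defs
  imports "HOL-Number_Theory.Cong" "HOL-Combinatorics.Permutations"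
begin

text \<open>
  A square of order \<open>n\<close> is a function \<open>L\<close> with \<open>L i j\<close> the entry in row \<open>i\<close> and
  column \<open>j\<close>; only its values for \<open>i\<close>, \<open>j\<close> in \<open>{1..n}\<close> matter. A row is a function of
  the column index.
\<close>

definition latin_square :: "nat \<Rightarrow> (nat \<Rightarrow> nat \<Rightarrow> nat) \<Rightarrow> bool" where
  "latin_square n L \<longleftrightarrow>
     (\<forall>i\<in>{1..n}. \<forall>j\<in>{1..n}. L i j \<in> {1..n}) \<and>
     (\<forall>i\<in>{1..n}. \<forall>v\<in>{1..n}. \<exists>!j. j \<in> {1..n} \<and> L i j = v) \<and>
     (\<forall>j\<in>{1..n}. \<forall>v\<in>{1..n}. \<exists>!i. i \<in> {1..n} \<and> L i j = v)"

definition torus_queen_move :: "nat \<Rightarrow> nat \<times> nat \<Rightarrow> nat \<times> nat \<Rightarrow> bool" where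
  "torus_queen_move n = (\<lambda>(i, j) (i', j').
     (i, j) \<noteq> (i', j') \<and>
     (i = i' \<or> j = j' \<or>
      [int i - int i' = int j - int j'] (mod int n) \<or>
      [int i - int i' = - (int j - int j')] (mod int n)))"

definition toroidal_anti_queen_latin_square :: "nat \<Rightarrow> (nat \<Rightarrow> nat \<Rightarrow> nat) \<Rightarrow> bool" where
  "toroidal_anti_queen_latin_square n L \<longleftrightarrow>
     latin_square n L \<and>
     (\<forall>i\<in>{1..n}. \<forall>j\<in>{1..n}. \<forall>i'\<in>{1..n}. \<forall>j'\<in>{1..n}.
        torus_queen_move n (i, j) (i', j') \<longrightarrow> L i j \<noteq> L i' j')"

text \<open>For \<open>n > 0\<close>, the representative in \<open>{1..n}\<close> of \<open>x\<close> modulo \<open>n\<close>.\<close>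

definition wrap :: "nat \<Rightarrow> int \<Rightarrow> nat" where
  "wrap n x = nat ((x - 1) mod int n) + 1"

text \<open>
  When a row is shifted to the left by \<open>k\<close>, the entry that arrives in column \<open>j\<close> comes
  from column \<open>j + k\<close>; when it is shifted to the right, from column \<open>j - k\<close>.
\<close>

definition shift_left :: "nat \<Rightarrow> int \<Rightarrow> (nat \<Rightarrow> nat) \<Rightarrow> nat \<Rightarrow> nat" where
  "shift_left n k r = (\<lambda>j. r (wrap n (int j + k)))"

definition shift_right :: "nat \<Rightarrow> int \<Rightarrow> (nat \<Rightarrow> nat) \<Rightarrow> nat \<Rightarrow> nat" where
  "shift_right n k r = (\<lambda>j. r (wrap n (int j - k)))"

text \<open>Rows are numbered from 1, so row \<open>i\<close> is the first row shifted \<open>i - 1\<close> times.\<close>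

definition shifted_square ::
  "((nat \<Rightarrow> nat) \<Rightarrow> nat \<Rightarrow> nat) \<Rightarrow> (nat \<Rightarrow> nat) \<Rightarrow> nat \<Rightarrow> nat \<Rightarrow> nat" where
  "shifted_square shift r i = (shift ^^ (i - 1)) r"

end

theory Submission imports Defs begin

text \<open>
  The cell \<open>(i, j)\<close> holds \<open>\<pi> (wrap n (j + (i - 1) k))\<close>, so two cells agree iff \<open>n\<close> divides
  \<open>(j - j') + (i - i') k\<close>. Along the lines \<open>j - j' = - c (i - i')\<close> with \<open>c = 0, 1, -1\<close> this
  becomes \<open>n dvd (i - i') (k - c)\<close>, which forces \<open>i = i'\<close> exactly when \<open>n\<close> and \<open>k - c\<close> are coprime.
\<close>

lemma wrap_mem: "n > 0 \<Longrightarrow> wrap n x \<in> {1..n}"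
  using pos_mod_bound[of "int n" "x - 1"] by (simp add: wrap_def Suc_le_eq nat_less_iff)

lemma cong_wrap: "n > 0 \<Longrightarrow> [int (wrap n x) = x] (mod int n)"
  by (simp add: wrap_def cong_def mod_simps)

lemma wrap_eq_iff: "n > 0 \<Longrightarrow> wrap n x = wrap n y \<longleftrightarrow> [x = y] (mod int n)"
  unfolding wrap_def cong_iff_dvd_diff
  by (simp add: eq_nat_nat_iff mod_eq_dvd_iff)

lemma wrap_id: "j \<in> {1..n} \<Longrightarrow> wrap n (int j) = j"
  by (auto simp: wrap_def)

text \<open>The range \<open>{1..n}\<close> is a complete residue system on which
  \<open>wrap n\<close> is the identity, so congruences between indices can be turned back into
  equalities of cells.\<close>

lemma cong_imp_eq:
  assumes "a \<in> {1..n}" "b \<in> {1..n}" "[int a = int b] (mod int n)"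
  shows "a = b"
  using assms wrap_eq_iff[of n "int a" "int b"] by (simp add: wrap_id)

text \<open>Induction with \<open>j\<close> arbitrary: unfolding the outermost shift moves the
  evaluation to column \<open>wrap n (j + k)\<close>, and the inner \<open>wrap\<close> is absorbed
  because the outer one sees only residues. For \<open>m = 0\<close> the claim rests on
  \<open>j \<in> {1..n}\<close>, where wrapping changes nothing.\<close>

lemma shift_left_funpow:
  assumes "n > 0" "j \<in> {1..n}"
  shows "(shift_left n k ^^ m) r j = r (wrap n (int j + int m * k))"
  using assms(2)
proof (induction m arbitrary: j)
  case 0
  then show ?case by (simp only: wrap_id funpow_0 of_nat_0 mult_zero_left add_0_right)
next
  case (Suc m)
  have "(shift_left n k ^^ Suc m) r j = (shift_left n k ^^ m) r (wrap n (int j + k))"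
    by (simp add: shift_left_def)
  also have "\<dots> = r (wrap n (int (wrap n (int j + k)) + int m * k))"
    using Suc.IH wrap_mem assms(1) by blast
  also have "wrap n (int (wrap n (int j + k)) + int m * k) = wrap n (int j + k + int m * k)"
    using assms(1) by (simp add: wrap_eq_iff cong_wrap cong_add_rcancel)
  finally show ?case by (simp add: algebra_simps)
qed

lemma shift_right_eq_shift_left: "shift_right n k = shift_left n (- k)"
  by (simp add: shift_left_def shift_right_def fun_eq_iff)

lemma shifted_square_shift_left:
  assumes "n > 0" "i \<in> {1..n}" "j \<in> {1..n}"
  shows "shifted_square (shift_left n k) r i j = r (wrap n (int j + (int i - 1) * k))"
  using assms by (simp add: shifted_square_def shift_left_funpow of_nat_diff)

lemma shifted_square_eq_iff:
  assumes "n > 0" "\<pi> permutes {1..n}"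
    and "i \<in> {1..n}" "j \<in> {1..n}" "i' \<in> {1..n}" "j' \<in> {1..n}"
  shows "shifted_square (shift_left n k) \<pi> i j = shifted_square (shift_left n k) \<pi> i' j' \<longleftrightarrow>
    int n dvd (int j - int j') + (int i - int i') * k"
proof -
  have "shifted_square (shift_left n k) \<pi> i j = shifted_square (shift_left n k) \<pi> i' j' \<longleftrightarrow>
      wrap n (int j + (int i - 1) * k) = wrap n (int j' + (int i' - 1) * k)"
    using assms by (simp add: shifted_square_shift_left inj_eq permutes_inj)
  also have "\<dots> \<longleftrightarrow> int n dvd (int j - int j') + (int i - int i') * k"
    using assms(1) by (simp add: wrap_eq_iff cong_iff_dvd_diff algebra_simps)
  finally show ?thesis .
qed

text \<open>An injective self-map of a finite set is onto. This reduces the Latin property to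
  injectivity along rows and columns.\<close>

lemma inj_on_imp_ex1:
  assumes "finite A" "inj_on f A" "\<And>x. x \<in> A \<Longrightarrow> f x \<in> A" "v \<in> A"
  shows "\<exists>!x. x \<in> A \<and> f x = v"
proof -
  have "f ` A = A"
    using assms by (intro endo_inj_surj) auto
  then show ?thesis
    using assms(2,4) by (metis (no_types, lifting) imageE inj_onD)
qed

lemma latin_squareI:
  assumes "\<And>i j. i \<in> {1..n} \<Longrightarrow> j \<in> {1..n} \<Longrightarrow> L i j \<in> {1..n}"
    and "\<And>i. i \<in> {1..n} \<Longrightarrow> inj_on (L i) {1..n}"
    and "\<And>j. j \<in> {1..n} \<Longrightarrow> inj_on (\<lambda>i. L i j) {1..n}"
  shows "latin_square n L"
  unfolding latin_square_def
  by (intro conjI ballI inj_on_imp_ex1 assms finite_atLeastAtMost)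

lemma coprime_dvd_diff_mult_imp_eq:
  assumes "coprime (int n) c" "int n dvd (int a - int b) * c" "a \<in> {1..n}" "b \<in> {1..n}"
  shows "a = b"
  using assms by (intro cong_imp_eq) (auto simp: cong_iff_dvd_diff coprime_dvd_mult_left_iff)

lemma shifted_square_anti_queen:
  assumes n: "n > 0" and \<pi>: "\<pi> permutes {1..n}"
    and k: "coprime (int n) k" "coprime (int n) (k - 1)" "coprime (int n) (k + 1)"
  shows "toroidal_anti_queen_latin_square n (shifted_square (shift_left n k) \<pi>)"
proof -
  let ?L = "shifted_square (shift_left n k) \<pi>"
  have queen: "?L i j \<noteq> ?L i' j'"
    if cells: "i \<in> {1..n}" "j \<in> {1..n}" "i' \<in> {1..n}" "j' \<in> {1..n}"
      and move: "torus_queen_move n (i, j) (i', j')" for i j i' j'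
  proof
    assume "?L i j = ?L i' j'"
    then have dvd: "int n dvd (int j - int j') + (int i - int i') * k"
      using shifted_square_eq_iff n \<pi> cells by blast
    have row: "j = j'" if "i = i'"
      using dvd cells that by (auto intro: cong_imp_eq simp: cong_iff_dvd_diff)
    \<comment> \<open>All three non-row directions at once: subtracting the equation of the line
      from the equality of entries cancels the column difference and leaves a multiple of
      \<open>k - c\<close>. A column is \<open>c = 0\<close>, the two diagonals are
      \<open>c = -1\<close> and \<open>c = 1\<close>.\<close>
    have line: "i = i'" if "coprime (int n) (k - c)"
        "int n dvd (int j - int j') + c * (int i - int i')" for c
    proof (rule coprime_dvd_diff_mult_imp_eq)
      have "(int i - int i') * (k - c) = ((int j - int j') + (int i - int i') * k)
          - ((int j - int j') + c * (int i - int i'))"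
        by (simp add: algebra_simps)
      then show "int n dvd (int i - int i') * (k - c)"
        using dvd_diff[OF dvd that(2)] by (simp only:)
    qed (use that cells in auto)
    consider "i = i'" | "j = j'" | "[int i - int i' = int j - int j'] (mod int n)"
      | "[int i - int i' = - (int j - int j')] (mod int n)"
      using move by (auto simp: torus_queen_move_def)
    then have "i = i'"
    proof cases
      case 2
      then show ?thesis using line[of 0] k by simp
    next
      case 3
      then have "int n dvd (int j - int j') + (-1) * (int i - int i')"
        unfolding cong_iff_dvd_diff by (subst dvd_minus_iff[symmetric]) (simp add: algebra_simps)
      then show ?thesis using line[of "-1"] k by simp
    next
      case 4
      then have "int n dvd (int j - int j') + 1 * (int i - int i')"
        unfolding cong_iff_dvd_diff by (simp add: algebra_simps)
      then show ?thesis using line[of 1] k by simp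
    qed
    \<comment> \<open>Once the rows agree, \<open>row\<close> makes the columns agree too, but a
      queen's move joins distinct cells.\<close>
    then show False
      using row move by (simp add: torus_queen_move_def)
  qed
  \<comment> \<open>Two cells in one row or one column are a queen's move apart, so
    \<open>queen\<close> already yields both injectivity conditions.\<close>
  have "latin_square n ?L"
  proof (rule latin_squareI)
    fix i j assume "i \<in> {1..n}" "j \<in> {1..n}"
    then show "?L i j \<in> {1..n}"
      using shifted_square_shift_left[OF n] permutes_in_image[OF \<pi>] wrap_mem[OF n] by metis
  next
    fix i assume i: "i \<in> {1..n}"
    show "inj_on (?L i) {1..n}"
    proof (rule inj_onI, rule ccontr)
      fix j j' assume "j \<in> {1..n}" "j' \<in> {1..n}" "?L i j = ?L i j'" "j \<noteq> j'"
      then show False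
        using queen[of i j i j'] i by (simp add: torus_queen_move_def)
    qed
  next
    fix j assume j: "j \<in> {1..n}"
    show "inj_on (\<lambda>i. ?L i j) {1..n}"
    proof (rule inj_onI, rule ccontr)
      fix i i' assume "i \<in> {1..n}" "i' \<in> {1..n}" "?L i j = ?L i' j" "i \<noteq> i'"
      then show False
        using queen[of i j i' j] j by (simp add: torus_queen_move_def)
    qed
  qed
  with queen show ?thesis
    unfolding toroidal_anti_queen_latin_square_def by blast
qed

text \<open>By contraposition: if \<open>d > 1\<close> is the gcd of \<open>n\<close> and
  \<open>k - c\<close>, then stepping \<open>e = n / d\<close> rows from the cell
  \<open>(1, 1)\<close> along the line belonging to \<open>c\<close> reaches another cell with the
  same entry.\<close>

lemma anti_queen_imp_coprime:
  assumes n: "n > 0" and \<pi>: "\<pi> permutes {1..n}"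
    and L: "toroidal_anti_queen_latin_square n (shifted_square (shift_left n k) \<pi>)"
    and c: "c \<in> {0, 1, -1}"
  shows "coprime (int n) (k - c)"
proof (rule ccontr)
  assume "\<not> coprime (int n) (k - c)"
  define d where "d = gcd (int n) (k - c)"
  have d: "d > 1"
    using \<open>\<not> coprime (int n) (k - c)\<close> n unfolding d_def
    by (metis coprime_iff_gcd_eq_1 gcd_pos_int less_irrefl_nat of_nat_0_eq_iff
        int_one_le_iff_zero_less order_le_less)
  obtain e where e: "int n = d * e"
    unfolding d_def by (meson dvdE gcd_dvd1)
  obtain f where f: "k - c = d * f"
    unfolding d_def by (meson dvdE gcd_dvd2)
  have e_pos: "e > 0"
    using e d n by (metis of_nat_0_less_iff zero_less_mult_pos less_trans zero_less_one)
  have e_less: "e < int n"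
    using e d e_pos by simp
  \<comment> \<open>The second cell is \<open>(1 + e, 1 - c * e)\<close>. Its row needs no wrapping
    since \<open>0 < e < n\<close>; its column may leave the square and is wrapped.\<close>
  define i where "i = nat (e + 1)"
  define j where "j = wrap n (1 - c * e)"
  have int_i: "int i = e + 1"
    using e_pos by (simp add: i_def)
  have cells: "i \<in> {1..n}" "j \<in> {1..n}" "1 \<in> {1..n}"
    using int_i e_pos e_less n wrap_mem by (auto simp: j_def)
  have "[int j = 1 - c * e] (mod int n)"
    unfolding j_def using n by (rule cong_wrap)
  then obtain t where t: "int j = 1 - c * e + int n * t"
    by (metis cong_iff_lin cong_sym)
  have "(int j - int 1) + (int i - int 1) * k = int n * t + e * (k - c)"
    by (simp add: t int_i algebra_simps)
  \<comment> \<open>Here \<open>e * (k - c) = e * d * f = n * f\<close>, which is why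
    \<open>e\<close> is the cofactor of the gcd.\<close>
  also have "\<dots> = int n * (t + f)"
    by (simp add: f e algebra_simps)
  finally have "int n dvd (int j - int 1) + (int i - int 1) * k"
    by simp
  then have "shifted_square (shift_left n k) \<pi> i j = shifted_square (shift_left n k) \<pi> 1 1"
    using shifted_square_eq_iff n \<pi> cells by blast
  moreover have "torus_queen_move n (i, j) (1, 1)"
  proof -
    have "i \<noteq> 1"
      using int_i e_pos by auto
    \<comment> \<open>A move within a column is defined by equality rather than congruence, so
      \<open>c = 0\<close> needs the exact value of \<open>j\<close>.\<close>
    moreover have "j = 1" if "c = 0"
      using that n wrap_id[of 1 n] by (simp add: j_def)
    ultimately show ?thesis
      using c by (auto simp: torus_queen_move_def cong_iff_dvd_diff t int_i)
  qed
  ultimately show False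
    using L cells unfolding toroidal_anti_queen_latin_square_def by blast
qed

lemma shift_left_anti_queen_iff:
  assumes "n > 0" "\<pi> permutes {1..n}"
  shows "toroidal_anti_queen_latin_square n (shifted_square (shift_left n k) \<pi>) \<longleftrightarrow>
    coprime (int n) k \<and> coprime (int n) (k - 1) \<and> coprime (int n) (k + 1)"
  using shifted_square_anti_queen[OF assms, of k]
    anti_queen_imp_coprime[OF assms, of k 0] anti_queen_imp_coprime[OF assms, of k 1]
    anti_queen_imp_coprime[OF assms, of k "-1"]
  by auto

theorem theorem11:
  fixes n :: nat and k :: int and \<pi> :: "nat \<Rightarrow> nat"
  assumes "n > 0"
    and "\<pi> permutes {1..n}"
  shows "(toroidal_anti_queen_latin_square n (shifted_square (shift_left n k) \<pi>) \<longleftrightarrow>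
            coprime (int n) k \<and> coprime (int n) (k - 1) \<and> coprime (int n) (k + 1)) \<and>
         (toroidal_anti_queen_latin_square n (shifted_square (shift_right n k) \<pi>) \<longleftrightarrow>
            coprime (int n) k \<and> coprime (int n) (k - 1) \<and> coprime (int n) (k + 1))"
proof -
  \<comment> \<open>A right shift by \<open>k\<close> is a left shift by \<open>- k\<close>, and
    this sign change merely swaps the conditions on \<open>k - 1\<close> and
    \<open>k + 1\<close>.\<close>
  have "coprime (int n) (- k - 1) \<longleftrightarrow> coprime (int n) (k + 1)"
    using coprime_minus_right_iff[of "int n" "k + 1"] by simp
  moreover have "coprime (int n) (- k + 1) \<longleftrightarrow> coprime (int n) (k - 1)"
    using coprime_minus_right_iff[of "int n" "k - 1"] by simp
  ultimately show ?thesis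
    by (auto simp: shift_right_eq_shift_left shift_left_anti_queen_iff[OF assms])
qed

end
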